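(* Let $f \in \mathcal{C}_{\mathcal{AP}}$, with Taylor expansion $f(z)=z+\sum_{n\ge 2}a_nz^n$, and let $\Gamma_1,\Gamma_2,\Gamma_3$ be its first three inverse logarithmic coefficients. Then \[ |\Gamma_1| \le \frac{3}{8}, \qquad |\Gamma_2| \le \frac{31}{192}, \qquad |\Gamma_3| \le \frac{205}{2304}. \] These bounds are sharp, i.e. for each of the three inequalities there is a function $f\in\mathcal{C}_{\mathcal{AP}}$ for which equality holds.
   Context: Let $\mathbb{D}=\{z\in\mathbb{C}:|z|<1\}$ and let $\mathcal{A}$ be the class of analytic functions $f$ in $\mathbb{D}$ normalized by $f(0)=0$, $f'(0)=1$, so that $f(z)=z+\sum_{n=2}^\infty a_nz^n$. For analytic $f,g$ in $\mathbb{D}$, $f$ is subordinate to $g$, written $f\prec g$, if there is a Schwarz function $\omega$ (analytic in $\mathbb{D}$, $\omega(0)=0$, $|\omega(z)|<1$ for $z\in\mathbb{D}$) with $f(z)=g(\omega(z))$ for all $z\in\mathbb{D}$. The apple-like convex class $\mathcal{C}_{\mathcal{AP}}$ consists of all $f\in\mathcal{A}$ with $1+\frac{zf''(z)}{f'(z)}\prec \psi_{\mathcal{AP}}(z)$ in $\mathbb{D}$, where $\psi_{\mathcal{AP}}(z)=e^{z}\sqrt{1+z}$ (branch of the square root with $\sqrt{1}=1$). It is a subclass of the class of normalized convex univalent functions. The inverse logarithmic coefficients $\Gamma_n$ of a univalent $f\in\mathcal{A}$ are defined by $\log\frac{f^{-1}(w)}{w}=2\sum_{n=1}^\infty\Gamma_nw^n$,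 $|w|<\frac14$. The first three are \[ \Gamma_1=-\tfrac12a_2,\qquad \Gamma_2=-\tfrac12a_3+\tfrac34a_2^2,\qquad \Gamma_3=-\tfrac12\left(a_4-4a_2a_3+\tfrac{10}{3}a_2^3\right). \] *)

theory Defs
  imports "HOL-Complex_Analysis.Complex_Analysis"
begin

abbreviation unit_disc :: "complex set" where
  "unit_disc \<equiv> ball 0 1"

text \<open>Functions on the disc are total functions of type \<^typ>\<open>complex \<Rightarrow> complex\<close>;
  their values outside the disc are irrelevant to all notions below.\<close>

definition class_A :: "(complex \<Rightarrow> complex) set" where
  "class_A = {f. f holomorphic_on unit_disc \<and> f 0 = 0 \<and> deriv f 0 = 1}"

definition schwarz_function :: "(complex \<Rightarrow> complex) \<Rightarrow> bool" where
  "schwarz_function \<omega> \<longleftrightarrow>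
     \<omega> holomorphic_on unit_disc \<and> \<omega> 0 = 0 \<and> (\<forall>z\<in>unit_disc. norm (\<omega> z) < 1)"

definition subordinate :: "(complex \<Rightarrow> complex) \<Rightarrow> (complex \<Rightarrow> complex) \<Rightarrow> bool" where
  "subordinate f g \<longleftrightarrow>
     f holomorphic_on unit_disc \<and> g holomorphic_on unit_disc \<and>
     (\<exists>\<omega>. schwarz_function \<omega> \<and> (\<forall>z\<in>unit_disc. f z = g (\<omega> z)))"

definition psi_AP :: "complex \<Rightarrow> complex" where
  "psi_AP z = exp z * csqrt (1 + z)"

text \<open>Division in HOL is total, so the quotient in the definition of the class is
  meaningful only where the derivative does not vanish. The nonvanishing is implicit in
  requiring the quotient to be analytic; it is spelled out here.\<close>

definition class_C_AP :: "(complex \<Rightarrow> complex) set" where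
  "class_C_AP = {f \<in> class_A. (\<forall>z\<in>unit_disc. deriv f z \<noteq> 0) \<and>
     subordinate (\<lambda>z. 1 + z * deriv (deriv f) z / deriv f z) psi_AP}"

text \<open>The function $\log (f^{-1}(w)/w)$, where $f^{-1}$ is the inverse of the univalent
  function $f$ on the disc. The removable singularity at $w = 0$ is filled in with
  $\log 1 = 0$, and since $f^{-1}(w)/w \to 1$ as $w \to 0$, the principal branch agrees near
  $0$ with the analytic branch that vanishes at $0$.\<close>

definition log_inverse_quotient :: "(complex \<Rightarrow> complex) \<Rightarrow> complex \<Rightarrow> complex" where
  "log_inverse_quotient f w = (if w = 0 then 0 else Ln (inv_into unit_disc f w / w))"

text \<open>$2\Gamma_n$ is the $n$-th Taylor coefficient at $0$ of that function. A power series
  is determined by its sum near its centre, so these are the coefficients of the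
  expansion on the whole disc of radius $1/4$.\<close>

definition inverse_log_coeff :: "(complex \<Rightarrow> complex) \<Rightarrow> nat \<Rightarrow> complex" where
  "inverse_log_coeff f n = (deriv ^^ n) (log_inverse_quotient f) 0 / fact n / 2"

end

theory Submission
  imports Defs
begin

text \<open>
  Let \<open>1 + z f'' / f' = psi_AP \<circ> \<omega>\<close> with a Schwarz function \<open>\<omega>(z) = c\<^sub>1 z + c\<^sub>2 z\<^sup>2 + c\<^sub>3 z\<^sup>3 + \<dots>\<close>.
  Since \<open>psi_AP(z) = 1 + 3/2 z + 7/8 z\<^sup>2 + 17/48 z\<^sup>3 + \<dots>\<close>, comparison of coefficients gives
  (\<open>inverse_log_coeffs_schwarz\<close>)

    \<open>\<Gamma>\<^sub>1 = - 3/8 c\<^sub>1\<close>,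
    \<open>\<Gamma>\<^sub>2 = - 1/8 (c\<^sub>2 - 31/24 c\<^sub>1\<^sup>2)\<close>,
    \<open>\<Gamma>\<^sub>3 = - 1/16 (c\<^sub>3 - 31/12 c\<^sub>1 c\<^sub>2 + 205/144 c\<^sub>1\<^sup>3)\<close>.

  The theorem says that each of these expressions is largest in modulus for \<open>\<omega>(z) = z\<close>, that is for
  \<open>c\<^sub>1 = 1\<close>, \<open>c\<^sub>2 = c\<^sub>3 = 0\<close>; in particular one function \<open>f\<close>, the solution of \<open>1 + z f'' / f' = psi_AP\<close>
  (\<open>extremal_function_exists\<close>), is extremal for all three bounds.

  The bounds rest on the Schur parametrisation of the coefficients of a Schwarz function
  (\<open>schwarz_coeffs\<close>): with \<open>a, x, y\<close> in the closed disc,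

    \<open>c\<^sub>1 = a\<close>, \<open>c\<^sub>2 = (1 - |a|\<^sup>2) x\<close>, \<open>c\<^sub>3 = (1 - |a|\<^sup>2) ((1 - |x|\<^sup>2) y - cnj a x\<^sup>2)\<close>.

  The second bound is then the triangle inequality. For the third one the triangle inequality
  may only be used to split off the term with \<open>y\<close>; the remaining terms partly cancel near \<open>|a| = 1\<close>,
  and completing a square bounds them uniformly in the argument of \<open>x\<close>
  (\<open>completed_square\<close>, \<open>sharp_cubic_bound\<close>).

  A separate matter is that the inverse logarithmic coefficients refer to a global inverse of \<open>f\<close>
  on the disc, so the local power series computation has to be tied to it. The function \<open>psi_AP\<close> has
  positive real part (\<open>Re_psi_AP_pos\<close>), so \<open>f\<close> satisfies the analytic convexity condition, hence
  the starlikeness condition (\<open>convex_imp_starlike\<close>). The latter makes \<open>|f|\<close> increase along each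
  radius. So \<open>f\<close> is bounded away from \<open>0\<close> outside every neighbourhood of \<open>0\<close>, and near \<open>0\<close> every
  right inverse of \<open>f\<close> with values in the disc is the holomorphic local inverse
  (\<open>inv_into_local_inverse\<close>).
\<close>

\<comment> \<open>Otherwise \<open>$\<close> would also be parsed as the indexing of vectors.\<close>
unbundle no vec_syntax

section \<open>Coefficients of products and compositions of power series\<close>

lemma has_fps_expansion_unique:
  fixes f g :: "complex \<Rightarrow> complex"
  assumes "f has_fps_expansion F" "g has_fps_expansion G" "eventually (\<lambda>z. f z = g z) (nhds 0)"
  shows "F = G"
proof -
  have "g has_fps_expansion F"
    using assms has_fps_expansion_cong by blast
  then show ?thesis
    using fps_nth_fps_expansion[OF assms(2)] fps_nth_fps_expansion by (intro fps_ext) metis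
qed

lemma eventually_unit_disc: 
  assumes "\<And>z. z \<in> unit_disc \<Longrightarrow> P z"
  shows "eventually P (nhds 0)"
  using assms eventually_nhds_in_open[of unit_disc 0] by (auto elim!: eventually_mono)

lemma fps_mult_nth_low:
  fixes f g :: "'a::comm_semiring_1 fps"
  shows "(f * g) $ 1 = f $ 0 * g $ 1 + f $ 1 * g $ 0"
    and "(f * g) $ 2 = f $ 0 * g $ 2 + f $ 1 * g $ 1 + f $ 2 * g $ 0"
    and "(f * g) $ 3 = f $ 0 * g $ 3 + f $ 1 * g $ 2 + f $ 2 * g $ 1 + f $ 3 * g $ 0"
  by (simp_all add: fps_mult_nth numeral_2_eq_2 numeral_3_eq_3)

lemma fps_compose_nth_low:
  fixes f g :: "'a::comm_ring_1 fps"
  assumes "g $ 0 = 0"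
  shows "(f oo g) $ 1 = f $ 1 * g $ 1"
    and "(f oo g) $ 2 = f $ 1 * g $ 2 + f $ 2 * (g $ 1)\<^sup>2"
    and "(f oo g) $ 3 = f $ 1 * g $ 3 + 2 * f $ 2 * g $ 1 * g $ 2 + f $ 3 * (g $ 1) ^ 3"
  using assms
  by (simp_all add: fps_compose_nth fps_mult_nth numeral_2_eq_2 numeral_3_eq_3 algebra_simps)

section \<open>Schur parameters of a Schwarz function\<close>

lemma strict_bound_or_constant:
  assumes "g holomorphic_on unit_disc" "\<And>z. z \<in> unit_disc \<Longrightarrow> norm (g z) \<le> 1"
    and "z0 \<in> unit_disc" "norm (g z0) = 1" "z \<in> unit_disc"
  shows "g z = g z0"
proof -
  have "g constant_on unit_disc"
    by (rule maximum_modulus_principle[where U = unit_disc and \<xi> = z0]) (use assms in auto)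
  then show ?thesis
    using assms unfolding constant_on_def by metis
qed

text \<open>The Schwarz lemma for functions that are only assumed to be bounded by \<open>1\<close> in the weak sense: if
the value \<open>1\<close> is attained, the maximum modulus principle makes \<open>u\<close> constant, which \<open>u 0 = 0\<close> excludes.\<close>

lemma schwarz_quotient:
  assumes "u holomorphic_on unit_disc" "u 0 = 0" "\<And>z. z \<in> unit_disc \<Longrightarrow> norm (u z) \<le> 1"
  obtains h where "h holomorphic_on unit_disc" "\<And>z. z \<in> unit_disc \<Longrightarrow> norm (h z) \<le> 1"
    "\<And>z. z \<in> unit_disc \<Longrightarrow> u z = z * h z"
proof -
  have lt: "norm (u z) < 1" if "norm z < 1" for z
  proof (rule ccontr)
    assume "\<not> norm (u z) < 1"
    then have "norm (u z) = 1" using assms(3)[of z] that by auto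
    then have "u 0 = u z" using strict_bound_or_constant[OF assms(1,3), of z 0] that by auto
    then show False using assms(2) \<open>norm (u z) = 1\<close> by auto
  qed
  obtain h where h: "h holomorphic_on unit_disc" "\<And>z. norm z < 1 \<Longrightarrow> u z = z * h z" "deriv u 0 = h 0"
    by (rule Schwarz3[OF assms(1,2)]) auto
  have "norm (h z) \<le> 1" if "norm z < 1" for z
  proof (cases "z = 0")
    case True
    then show ?thesis using Schwarz_Lemma(2)[OF assms(1,2) lt that] h by auto
  next
    case False
    then show ?thesis using Schwarz_Lemma(1)[OF assms(1,2) lt that] h(2)[OF that]
      by (simp add: norm_mult mult_le_cancel_left1)
  qed
  then show thesis using that h by auto
qed

lemma moebius_norm_le:
  fixes a w :: complex
  assumes "norm a < 1" "norm w \<le> 1"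
  shows "1 - cnj a * w \<noteq> 0" "norm ((w - a) / (1 - cnj a * w)) \<le> 1"
proof -
  have "norm (cnj a * w) < 1"
    using assms by (simp add: norm_mult) (metis mult_left_le norm_ge_zero order_le_less_trans)
  then show nz: "1 - cnj a * w \<noteq> 0" by auto
  have "(norm (1 - cnj a * w))\<^sup>2 - (norm (w - a))\<^sup>2 = (1 - (norm a)\<^sup>2) * (1 - (norm w)\<^sup>2)"
    unfolding cmod_power2 by (simp add: algebra_simps power2_eq_square)
  moreover have "\<dots> \<ge> 0" using assms by (simp add: power_le_one)
  ultimately have "(norm (w - a))\<^sup>2 \<le> (norm (1 - cnj a * w))\<^sup>2"
    by linarith
  then have "norm (w - a) \<le> norm (1 - cnj a * w)"
    by (rule power2_le_imp_le) simp
  then show "norm ((w - a) / (1 - cnj a * w)) \<le> 1"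
    using nz by (simp add: norm_divide divide_le_eq_1)
qed

text \<open>One step of the Schur algorithm. The disc automorphism that moves \<open>g 0\<close> to \<open>0\<close> turns \<open>g\<close> into a
function to which the Schwarz lemma applies. Written without a quotient, the relation also covers
the degenerate case \<open>|g 0| = 1\<close>, where \<open>g\<close> is constant and \<open>h = 0\<close> will do.\<close>

lemma schur_step:
  assumes g: "g holomorphic_on unit_disc" "\<And>z. z \<in> unit_disc \<Longrightarrow> norm (g z) \<le> 1"
  obtains h where "h holomorphic_on unit_disc" "\<And>z. z \<in> unit_disc \<Longrightarrow> norm (h z) \<le> 1"
    "\<And>z. z \<in> unit_disc \<Longrightarrow> g z - g 0 = z * h z * (1 - cnj (g 0) * g z)"
proof (cases "norm (g 0) = 1")
  case True
  have "g z = g 0" if "z \<in> unit_disc" for z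
    by (rule strict_bound_or_constant[OF g _ True that]) auto
  then have "\<And>z. z \<in> unit_disc \<Longrightarrow> g z - g 0 = z * 0 * (1 - cnj (g 0) * g z)"
    by (metis diff_self mult_zero_left mult_zero_right)
  then show ?thesis
    by (rule that[of "\<lambda>_. 0", OF holomorphic_on_const, rotated]) simp_all
next
  case False
  then have a: "norm (g 0) < 1" using g(2)[of 0] by auto
  define u where "u = (\<lambda>z. (g z - g 0) / (1 - cnj (g 0) * g z))"
  have nz: "1 - cnj (g 0) * g z \<noteq> 0" if "z \<in> unit_disc" for z
    using moebius_norm_le(1)[OF a g(2)[OF that]] .
  have "u holomorphic_on unit_disc"
    unfolding u_def using g(1) nz by (intro holomorphic_intros) auto
  moreover have "norm (u z) \<le> 1" if "z \<in> unit_disc" for z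
    using moebius_norm_le(2)[OF a g(2)[OF that]] unfolding u_def .
  ultimately obtain h where "h holomorphic_on unit_disc" "\<And>z. z \<in> unit_disc \<Longrightarrow> norm (h z) \<le> 1"
    "\<And>z. z \<in> unit_disc \<Longrightarrow> u z = z * h z"
    using schwarz_quotient[of u] by (simp add: u_def) blast
  moreover have "g z - g 0 = u z * (1 - cnj (g 0) * g z)" if "z \<in> unit_disc" for z
    using nz[OF that] by (simp add: u_def)
  ultimately show ?thesis using that[of h] by simp
qed

lemma schur_step_fps:
  assumes "g holomorphic_on unit_disc" "\<And>z. z \<in> unit_disc \<Longrightarrow> norm (g z) \<le> 1"
    and G: "g has_fps_expansion G"
  obtains h H where "h holomorphic_on unit_disc" "\<And>z. z \<in> unit_disc \<Longrightarrow> norm (h z) \<le> 1"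
    "h has_fps_expansion H"
    "G - fps_const (G $ 0) = fps_X * H * (1 - fps_const (cnj (G $ 0)) * G)"
proof -
  obtain h where h: "h holomorphic_on unit_disc" "\<And>z. z \<in> unit_disc \<Longrightarrow> norm (h z) \<le> 1"
    "\<And>z. z \<in> unit_disc \<Longrightarrow> g z - g 0 = z * h z * (1 - cnj (g 0) * g z)"
    by (rule schur_step[OF assms(1,2)]) auto
  have g0: "g 0 = G $ 0"
    using G has_fps_expansion_imp_0_eq_fps_nth_0 by blast
  define H where "H = fps_expansion h 0"
  have H: "h has_fps_expansion H"
    unfolding H_def using h(1) by (intro has_fps_expansion_fps_expansion[of unit_disc]) auto
  have "G - fps_const (G $ 0) = fps_X * H * (1 - fps_const (cnj (G $ 0)) * G)"
  proof (rule has_fps_expansion_unique)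
    show "(\<lambda>z. g z - G $ 0) has_fps_expansion G - fps_const (G $ 0)"
      by (intro fps_expansion_intros G)
    show "(\<lambda>z. z * h z * (1 - cnj (G $ 0) * g z)) has_fps_expansion
            fps_X * H * (1 - fps_const (cnj (G $ 0)) * G)"
      by (intro fps_expansion_intros G H)
    show "\<forall>\<^sub>F z in nhds 0. g z - G $ 0 = z * h z * (1 - cnj (G $ 0) * g z)"
      by (rule eventually_unit_disc) (use h(3) g0 in auto)
  qed
  then show thesis using that h H by blast
qed

text \<open>Three Schur steps, applied to \<open>\<omega>\<close>, then to \<open>g\<close> with \<open>\<omega> = z g\<close>, and then to its successor \<open>h\<close>. The
parameters \<open>a, x, y\<close> are the values at \<open>0\<close> of the three functions produced.\<close>

lemma schwarz_coeffs:
  assumes "schwarz_function \<omega>" "\<omega> has_fps_expansion W"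
  obtains a x y where "norm a \<le> 1" "norm x \<le> 1" "norm y \<le> 1"
    "W $ 0 = 0" "W $ 1 = a" "W $ 2 = (1 - a * cnj a) * x"
    "W $ 3 = (1 - a * cnj a) * ((1 - x * cnj x) * y - cnj a * x\<^sup>2)"
proof -
  have w: "\<omega> holomorphic_on unit_disc" "\<And>z. z \<in> unit_disc \<Longrightarrow> norm (\<omega> z) \<le> 1" "\<omega> 0 = 0"
    using assms(1) unfolding schwarz_function_def by (auto intro: less_imp_le)
  have W0: "W $ 0 = 0"
    using assms(2) has_fps_expansion_imp_0_eq_fps_nth_0 w(3) by metis
  obtain g G where g: "g holomorphic_on unit_disc" "\<And>z. z \<in> unit_disc \<Longrightarrow> norm (g z) \<le> 1"
    and G: "g has_fps_expansion G"
      "W - fps_const (W $ 0) = fps_X * G * (1 - fps_const (cnj (W $ 0)) * W)"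
    using schur_step_fps[OF w(1,2) assms(2)] by metis
  obtain h H where h: "h holomorphic_on unit_disc" "\<And>z. z \<in> unit_disc \<Longrightarrow> norm (h z) \<le> 1"
    and H: "h has_fps_expansion H"
      "G - fps_const (G $ 0) = fps_X * H * (1 - fps_const (cnj (G $ 0)) * G)"
    using schur_step_fps[OF g G(1)] by metis
  obtain k K where k: "k holomorphic_on unit_disc" "\<And>z. z \<in> unit_disc \<Longrightarrow> norm (k z) \<le> 1"
    and K: "k has_fps_expansion K"
      "H - fps_const (H $ 0) = fps_X * K * (1 - fps_const (cnj (H $ 0)) * H)"
    using schur_step_fps[OF h H(1)] by metis
  have WG: "W = fps_X * G" using G(2) W0 by simp
  have W: "W $ 1 = G $ 0" "W $ 2 = G $ 1" "W $ 3 = G $ 2"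
    by (simp_all add: WG)
  have eqG: "(G - fps_const (G $ 0)) $ n = (fps_X * (H * (1 - fps_const (cnj (G $ 0)) * G))) $ n" for n
    using H(2) by (simp add: mult.assoc)
  have eqH: "(H - fps_const (H $ 0)) $ n = (fps_X * (K * (1 - fps_const (cnj (H $ 0)) * H))) $ n" for n
    using K(2) by (simp add: mult.assoc)
  have G1: "G $ 1 = H $ 0 * (1 - cnj (G $ 0) * G $ 0)"
    using eqG[of 1] by simp
  have G2: "G $ 2 = H $ 1 * (1 - cnj (G $ 0) * G $ 0) - H $ 0 * cnj (G $ 0) * G $ 1"
    using eqG[of 2] by (simp add: fps_mult_nth_low[unfolded One_nat_def])
  have H1: "H $ 1 = K $ 0 * (1 - cnj (H $ 0) * H $ 0)"
    using eqH[of 1] by simp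
  show thesis
  proof (rule that[of "G $ 0" "H $ 0" "K $ 0"])
    show "norm (G $ 0) \<le> 1" "norm (H $ 0) \<le> 1" "norm (K $ 0) \<le> 1"
      using g(2)[of 0] h(2)[of 0] k(2)[of 0] G(1) H(1) K(1) has_fps_expansion_imp_0_eq_fps_nth_0
      by (metis centre_in_ball zero_less_one)+
    show "W $ 3 = (1 - G $ 0 * cnj (G $ 0)) * ((1 - H $ 0 * cnj (H $ 0)) * K $ 0 - cnj (G $ 0) * (H $ 0)\<^sup>2)"
      unfolding W G2 G1 H1 by (simp add: algebra_simps power2_eq_square)
  qed (use W0 W G1 in \<open>auto simp: algebra_simps\<close>)
qed

section \<open>The extremal problems in the Schur parameters\<close>

text \<open>Put \<open>N = |a|\<^sup>2\<close>, \<open>t = |x|\<^sup>2\<close> and \<open>R = Re (cnj a\<^sup>2 x)\<close>. For fixed \<open>N\<close> and \<open>t\<close> the squared norm below is a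
quadratic polynomial in \<open>R\<close> with leading coefficient \<open>- 4 n s\<close>. For \<open>n, s > 0\<close>, completing the square
gives a bound that does not depend on the argument of \<open>x\<close>; this bound factors as on the right-hand
side.\<close>

lemma completed_square:
  fixes a x :: complex and s m n :: real
  shows "4 * n * (norm (of_real n * a ^ 3 + of_real m * of_real s * a * x - of_real s * cnj a * x\<^sup>2))\<^sup>2
     + s * (4 * n * Re ((cnj a)\<^sup>2 * x) + m * (s * (norm x)\<^sup>2 - n * (norm a)\<^sup>2))\<^sup>2
     = (s * (norm x)\<^sup>2 + n * (norm a)\<^sup>2)\<^sup>2 * (4 * n * (norm a)\<^sup>2 + m\<^sup>2 * s)"
proof -
  define p q u v where "p = Re a" "q = Im a" "u = Re x" "v = Im x"
  note pquv = this[symmetric]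
  define N t R where "N = p * p + q * q" "t = u * u + v * v"
    "R = (p * p - q * q) * u + 2 * p * q * v"
  note NtR = this
  have *: "(norm (of_real n * a ^ 3 + of_real m * of_real s * a * x - of_real s * cnj a * x\<^sup>2))\<^sup>2
     = n * n * N * N * N + m * m * s * s * N * t + s * s * N * t * t + 2 * n * m * s * N * R
       - 2 * n * s * (2 * R * R - N * N * t) - 2 * m * s * s * t * R"
    unfolding cmod_power2 NtR by (simp add: pquv power2_eq_square power3_eq_cube algebra_simps)
  have R: "Re ((cnj a)\<^sup>2 * x) = R" unfolding NtR by (simp add: pquv power2_eq_square algebra_simps)
  have N: "(norm a)\<^sup>2 = N" "(norm x)\<^sup>2 = t" unfolding cmod_power2 NtR by (simp_all add: pquv power2_eq_square)
  show ?thesis unfolding * R N by (simp add: power2_eq_square algebra_simps)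
qed

text \<open>With \<open>n = 205/144\<close>, \<open>m = - 31/12\<close> and \<open>s = 1 - |a|\<^sup>2\<close>, the completed square bounds the terms without
\<open>y\<close> by \<open>(s |x|\<^sup>2 + n |a|\<^sup>2) sqrt (1 + 141/820 s)\<close>, where \<open>141/820 = m\<^sup>2 / (4 n) - 1\<close>. The square root is at
most \<open>1 + 141/1640 s\<close>. The resulting estimate is largest for \<open>|x| = 1\<close>, and then it is a polynomial
in \<open>s\<close> that does not exceed its value \<open>n\<close> at \<open>s = 0\<close>.\<close>

lemma sharp_cubic_bound:
  fixes a x y :: complex
  assumes "norm a \<le> 1" "norm x \<le> 1" "norm y \<le> 1"
  shows "norm ((1 - a * cnj a) * ((1 - x * cnj x) * y - cnj a * x\<^sup>2)
     - 31/12 * a * ((1 - a * cnj a) * x) + 205/144 * a ^ 3) \<le> 205/144"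
proof -
  define s where "s = 1 - (norm a)\<^sup>2"
  define t where "t = (norm x)\<^sup>2"
  define n :: real where "n = 205/144"
  define m :: real where "m = -31/12"
  define A where "A = of_real n * a ^ 3 + of_real m * of_real s * a * x - of_real s * cnj a * x\<^sup>2"
  have s: "0 \<le> s" "s \<le> 1" using assms by (auto simp: s_def power_le_one)
  have t: "0 \<le> t" "t \<le> 1" using assms by (auto simp: t_def power_le_one)
  have n: "n > 0" by (simp add: n_def)
  have sc: "1 - a * cnj a = of_real s"
    unfolding s_def using complex_norm_square[of a] by simp
  have tc: "1 - x * cnj x = of_real (1 - t)"
    unfolding t_def using complex_norm_square[of x] by simp
  have a2: "(norm a)\<^sup>2 = 1 - s" by (simp add: s_def)
  have B0: "0 \<le> s * t + n * (1 - s)" using s t n by simp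
  have "4 * n * (norm A)\<^sup>2 \<le> (s * t + n * (1 - s))\<^sup>2 * (4 * n * (1 - s) + m\<^sup>2 * s)"
    using completed_square[of n a m s x] s unfolding A_def[symmetric] t_def[symmetric] a2
    by (smt (verit) mult_nonneg_nonneg zero_le_power2)
  also have "4 * n * (1 - s) + m\<^sup>2 * s = 4 * n * (1 + 141/820 * s)"
    by (simp add: n_def m_def power2_eq_square field_simps)
  finally have "(norm A)\<^sup>2 \<le> (s * t + n * (1 - s))\<^sup>2 * (1 + 141/820 * s)"
    using n by (simp add: mult.left_commute)
  also have "\<dots> \<le> (s * t + n * (1 - s))\<^sup>2 * (1 + 141/1640 * s)\<^sup>2"
  proof (rule mult_left_mono)
    show "1 + 141/820 * s \<le> (1 + 141/1640 * s)\<^sup>2"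
      by (simp add: power2_eq_square algebra_simps)
  qed simp
  finally have A: "norm A \<le> (s * t + n * (1 - s)) * (1 + 141/1640 * s)"
    unfolding power_mult_distrib[symmetric] by (rule power2_le_imp_le) (use B0 s in simp)
  have "norm ((1 - a * cnj a) * ((1 - x * cnj x) * y - cnj a * x\<^sup>2)
     - 31/12 * a * ((1 - a * cnj a) * x) + 205/144 * a ^ 3) = norm (of_real (s * (1 - t)) * y + A)"
    unfolding sc tc A_def n_def m_def by (simp add: algebra_simps)
  also have "\<dots> \<le> s * (1 - t) * norm y + norm A"
    using s t by (intro norm_triangle_le) (simp add: norm_mult del: of_real_mult of_real_diff)
  also have "\<dots> \<le> s * (1 - t) + (s * t + n * (1 - s)) * (1 + 141/1640 * s)"
    using A s t assms(3) by (intro add_mono) (auto intro: mult_left_le)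
  \<comment> \<open>Enlarging the first term makes the sum independent of \<open>|x|\<close>.\<close>
  also have "\<dots> \<le> s * (1 - t) * (1 + 141/1640 * s) + (s * t + n * (1 - s)) * (1 + 141/1640 * s)"
    using s t by (simp add: algebra_simps mult_left_mono)
  also have "\<dots> = (n - (n - 1) * s) * (1 + 141/1640 * s)"
    by algebra
  also have "\<dots> = n - s * (n - 1 - 141/1640 * n) - (n - 1) * 141/1640 * s\<^sup>2"
    by algebra
  also have "\<dots> \<le> n"
  proof -
    have "0 \<le> s * (n - 1 - 141/1640 * n)" "0 \<le> (n - 1) * 141/1640 * s\<^sup>2"
      using s by (simp_all add: n_def)
    then show ?thesis by linarith
  qed
  finally show ?thesis by (simp add: n_def)
qed

lemma sharp_quadratic_bound:
  fixes a x :: complex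
  assumes "norm a \<le> 1" "norm x \<le> 1"
  shows "norm ((1 - a * cnj a) * x - 31/24 * a\<^sup>2) \<le> 31/24"
proof -
  define s where "s = 1 - (norm a)\<^sup>2"
  have s: "0 \<le> s" using assms by (auto simp: s_def power_le_one)
  have sc: "1 - a * cnj a = of_real s"
    unfolding s_def using complex_norm_square[of a] by simp
  have "norm ((1 - a * cnj a) * x - 31/24 * a\<^sup>2) \<le> s * norm x + 31/24 * (norm a)\<^sup>2"
    unfolding sc by (rule order_trans[OF norm_triangle_ineq4]) (use s in \<open>auto simp: norm_mult norm_power\<close>)
  also have "\<dots> \<le> s + 31/24 * (1 - s)"
    using mult_left_le[OF assms(2) s] by (simp add: s_def)
  also have "\<dots> \<le> 31/24" using s by argo
  finally show ?thesis .
qed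

section \<open>Positivity of the real part of the apple-like function\<close>

lemma one_plus_notin_nonpos_Reals:
  assumes "z \<in> unit_disc"
  shows "1 + z \<notin> \<real>\<^sub>\<le>\<^sub>0"
  using assms abs_Re_le_cmod[of z] by (auto simp: complex_nonpos_Reals_iff)

lemma psi_AP_holomorphic: "psi_AP holomorphic_on unit_disc"
  unfolding psi_AP_def[abs_def]
  by (intro holomorphic_intros) (use one_plus_notin_nonpos_Reals in auto)

text \<open>The left-hand side is the argument of \<open>psi_AP\<close> at \<open>x + i y\<close>, to be bounded by its value at the boundary
point \<open>- cos u + i sin u\<close>, where \<open>sin u = y\<close>. There \<open>y / (1 + x)\<close> is \<open>cot (u/2)\<close>, so the argument
becomes \<open>sin u + pi/4 - u/4\<close>, and the claim reduces to \<open>sin u - u/4 \<le> pi/4\<close>. This holds with room to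
spare: use \<open>sin u \<le> u\<close> for small \<open>u\<close> and \<open>sin u \<le> 1\<close> for the others.\<close>

lemma arg_estimate:
  fixes x y :: real
  assumes "x\<^sup>2 + y\<^sup>2 < 1" "y > 0"
  shows "y + arctan (y / (1 + x)) / 2 < pi / 2"
proof -
  have y1: "y < 1"
  proof (rule ccontr)
    assume "\<not> y < 1"
    then have "y\<^sup>2 \<ge> 1" by simp
    then show False using assms(1) zero_le_power2[of x] by linarith
  qed
  define u where "u = arcsin y"
  have u: "0 < u" "u < pi / 2"
    unfolding u_def using assms(2) y1 arcsin_less_arcsin[of 0 y] arcsin_lt_bounded[of y] by auto
  have sin: "sin u = y" unfolding u_def using assms(2) y1 by simp
  have cos: "cos u > 0" using u cos_gt_zero by auto
  have "x\<^sup>2 < (cos u)\<^sup>2"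
    using assms(1) sin sin_cos_squared_add[of u] by simp
  then have "\<bar>x\<bar> < cos u" using cos by (metis power2_less_imp_less power2_abs less_imp_le)
  then have x: "1 + x > 1 - cos u" by linarith
  have cl1: "cos u < 1"
    using cos_monotone_0_pi[of 0 u] u by simp
  have "y / (1 + x) < y / (1 - cos u)"
    using x cl1 assms(2) by (intro divide_strict_left_mono) auto
  also have "y / (1 - cos u) = tan (pi / 2 - u / 2)"
  proof -
    have "sin u = 2 * sin (u/2) * cos (u/2)" using sin_double[of "u/2"] by simp
    moreover have "1 - cos u = 2 * (sin (u/2))\<^sup>2" using cos_double_sin[of "u/2"] by simp
    moreover have "sin (u/2) > 0" using u by (intro sin_gt_zero) auto
    ultimately have "y / (1 - cos u) = cos (u/2) / sin (u/2)"
      using sin by (simp add: power2_eq_square)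
    then show ?thesis by (simp add: tan_def cos_diff sin_diff)
  qed
  finally have "arctan (y / (1 + x)) < arctan (tan (pi / 2 - u / 2))"
    by (simp add: arctan_less_iff)
  also have "\<dots> = pi / 2 - u / 2"
    using u by (intro arctan_tan) auto
  finally have "y + arctan (y / (1 + x)) / 2 < pi / 4 + (sin u - u / 4)"
    using sin by simp
  moreover have pi: "pi > 31 / 10" using pi_approx(1) by simp
  have "sin u - u / 4 \<le> pi / 4"
  proof (cases "u < 9/10")
    case True
    then show ?thesis using sin_x_le_x[of u] u pi_gt3 by linarith
  next
    case False
    then show ?thesis using sin_le_one[of u] pi by linarith
  qed
  ultimately show ?thesis by linarith
qed

lemma Re_psi_AP_pos:
  assumes "z \<in> unit_disc"
  shows "Re (psi_AP z) > 0"
proof -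
  have n: "(Re z)\<^sup>2 + (Im z)\<^sup>2 < 1"
    using assms by (metis cmod_power2 mem_ball_0 norm_ge_zero power_less_one_iff zero_less_numeral)
  have re: "Re (1 + z) > 0" using assms abs_Re_le_cmod[of z] by auto
  then have nz: "1 + z \<noteq> 0" by (metis less_irrefl zero_complex.sel(1))
  define t where "t = arctan (Im z / (1 + Re z))"
  have Arg: "Im (Ln (1 + z)) = t"
    using re nz by (simp add: t_def Arg_eq_Im_Ln[symmetric] arg_conv_arctan)
  have "psi_AP z = exp (z + Ln (1 + z) / 2)"
    unfolding psi_AP_def using nz by (simp add: csqrt_exp_Ln exp_add)
  then have eq: "Re (psi_AP z) = exp (Re (z + Ln (1 + z) / 2)) * cos (Im z + t / 2)"
    using Arg by (simp add: Re_exp)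
  have "\<bar>Im z + t / 2\<bar> < pi / 2"
  proof (cases "Im z" "0::real" rule: linorder_cases)
    case greater
    have "t > 0" unfolding t_def using greater re by simp
    then show ?thesis using arg_estimate[OF n greater] greater by (simp add: t_def)
  next
    case equal
    then show ?thesis by (simp add: t_def)
  next
    case less
    have "t < 0" unfolding t_def using less re by (simp add: divide_neg_pos)
    moreover have "arctan (- Im z / (1 + Re z)) = - t" unfolding t_def by (simp add: arctan_minus)
    ultimately show ?thesis using arg_estimate[of "Re z" "- Im z"] n less by simp
  qed
  then have "cos (Im z + t / 2) > 0" by (intro cos_gt_zero_pi) linarith+
  then show ?thesis unfolding eq by simp
qed

section \<open>From convexity to growth along radii\<close>

lemma DERIV_Re_along_curve:
  assumes "(\<gamma> has_vector_derivative v) (at t)" "(g has_field_derivative g') (at (\<gamma> t))"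
  shows "((\<lambda>t. Re (g (\<gamma> t))) has_real_derivative Re (v * g')) (at t)"
  using has_field_derivative_Re[OF field_vector_diff_chain_at[OF assms]]
  by (simp add: o_def)

text \<open>The quotient \<open>q = f / (z f')\<close> satisfies \<open>z q' = 1 - q p\<close> with \<open>p = 1 + z f'' / f'\<close>, and \<open>q 0 = 1\<close>. Suppose
that \<open>Re q\<close> is not positive everywhere, and let \<open>z0\<close> be a point of least modulus with \<open>Re (q z0) \<le> 0\<close>.
Then \<open>Re (q z0) = 0\<close> is a minimum of \<open>Re q\<close> both along the circle through \<open>z0\<close> and along the radius to \<open>z0\<close>,
so \<open>z0 q' z0\<close> is real and at most \<open>0\<close>. Since \<open>q z0\<close> is purely imaginary, the
differential equation then forces \<open>Re (p z0) = 0\<close>, contrary to convexity.\<close>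

lemma convex_imp_starlike:
  assumes f: "f holomorphic_on unit_disc" "f 0 = 0"
    and nz: "\<And>z. z \<in> unit_disc \<Longrightarrow> deriv f z \<noteq> 0"
    and pos: "\<And>z. z \<in> unit_disc \<Longrightarrow> Re (1 + z * deriv (deriv f) z / deriv f z) > 0"
    and z: "z \<in> unit_disc" "z \<noteq> 0"
  shows "Re (f z / (z * deriv f z)) > 0"
proof -
  have df: "deriv f holomorphic_on unit_disc"
    using f(1) by (intro holomorphic_deriv) auto
  define F where "F = (\<lambda>z. f z / deriv f z)"
  have holF: "F holomorphic_on unit_disc"
    unfolding F_def using f df nz by (intro holomorphic_intros) auto
  obtain q where q: "q holomorphic_on unit_disc" "\<And>z. norm z < 1 \<Longrightarrow> F z = z * q z"
    by (rule Schwarz3[OF holF]) (auto simp: F_def f(2))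
  define p where "p = (\<lambda>z. 1 + z * deriv (deriv f) z / deriv f z)"
  have ode: "z * deriv q z + q z = 1 - q z * (p z - 1)" if z: "z \<in> unit_disc" for z
  proof -
    have "(f has_field_derivative deriv f z) (at z)"
      using f(1) z by (intro holomorphic_derivI) auto
    moreover have "(deriv f has_field_derivative deriv (deriv f) z) (at z)"
      using df z by (intro holomorphic_derivI) auto
    ultimately have "(F has_field_derivative
        (deriv f z * deriv f z - f z * deriv (deriv f) z) / (deriv f z * deriv f z)) (at z)"
      unfolding F_def using nz[OF z] by (intro DERIV_divide)
    moreover have "(F has_field_derivative z * deriv q z + q z) (at z)"
    proof (rule has_field_derivative_transform_within_open[of "\<lambda>z. z * q z" _ _ unit_disc])
      show "((\<lambda>z. z * q z) has_field_derivative z * deriv q z + q z) (at z)"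
        using holomorphic_derivI[OF q(1) _ z] by (auto intro!: derivative_eq_intros)
    qed (use q(2) z in auto)
    ultimately have "z * deriv q z + q z =
        (deriv f z * deriv f z - f z * deriv (deriv f) z) / (deriv f z * deriv f z)"
      by (rule DERIV_unique[rotated])
    also have "\<dots> = 1 - F z * deriv (deriv f) z / deriv f z"
      using nz[OF z] by (simp add: F_def field_simps)
    also have "\<dots> = 1 - q z * (p z - 1)"
      using q(2)[of z] z by (simp add: p_def)
    finally show ?thesis .
  qed
  have q0: "q 0 = 1" using ode[of 0] by (simp add: p_def)
  have contq: "continuous_on unit_disc q"
    using q(1) by (rule holomorphic_on_imp_continuous_on)
  have qpos: "Re (q z) > 0" if "z \<in> unit_disc" for z
  proof (rule ccontr)
    assume neg: "\<not> Re (q z) > 0"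
    define r where "r = norm z"
    have r: "r < 1" using that by (simp add: r_def)
    define B where "B = {w \<in> cball 0 r. Re (q w) \<le> 0}"
    have contr: "continuous_on (cball 0 r) (\<lambda>w. Re (q w))"
      using r by (intro continuous_intros continuous_on_subset[OF contq]) auto
    have "closed B"
      unfolding B_def using continuous_closed_preimage[OF contr, of "{..0}"]
      by (simp add: vimage_def Int_def conj_commute)
    moreover have "bounded B"
      unfolding B_def by (rule bounded_subset[of "cball 0 r"]) auto
    ultimately have "compact B" by (simp add: compact_eq_bounded_closed)
    moreover have "B \<noteq> {}" using neg by (auto simp: B_def r_def)
    ultimately obtain z0 where z0: "z0 \<in> B" "\<And>w. w \<in> B \<Longrightarrow> norm z0 \<le> norm w"
      using continuous_attains_inf[of B norm] continuous_on_norm_id by blast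
    have z0': "norm z0 \<le> r" "Re (q z0) \<le> 0" using z0(1) by (auto simp: B_def)
    have z0D: "z0 \<in> unit_disc" using z0' r by auto
    have z00: "z0 \<noteq> 0" using z0' q0 by auto
    have inside: "Re (q w) > 0" if "norm w < norm z0" for w
      using z0(2)[of w] that z0'(1) by (force simp: B_def)
    have dq: "(q has_field_derivative deriv q z0) (at z0)"
      using q(1) z0D by (intro holomorphic_derivI) auto
    have outside: "0 \<le> Re (q w)" if "norm w = norm z0" for w
    proof (rule continuous_ge_on_closure[where S = "ball 0 (norm z0)" and f = "\<lambda>w. Re (q w)"])
      have "closure (ball 0 (norm z0)) = cball (0::complex) (norm z0)"
        using z00 by simp
      then show "continuous_on (closure (ball 0 (norm z0))) (\<lambda>w. Re (q w))"
        "w \<in> closure (ball 0 (norm z0))"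
        using continuous_on_subset[OF contr subset_cball[OF z0'(1)]] that by auto
    qed (use inside less_imp_le in auto)
    have Re0: "Re (q z0) = 0" using outside[of z0] z0'(2) by simp
    have radial: "((\<lambda>t. Re (q (of_real t * z0))) has_real_derivative Re (z0 * deriv q z0)) (at 1)"
    proof (rule DERIV_Re_along_curve[where g = q and \<gamma> = "\<lambda>t. of_real t * z0"])
      show "((\<lambda>t. of_real t * z0) has_vector_derivative z0) (at 1)"
        by (auto intro!: derivative_eq_intros)
    qed (use dq in simp)
    have tangential: "((\<lambda>t. Re (q (exp (\<i> * of_real t) * z0))) has_real_derivative
        Re (\<i> * z0 * deriv q z0)) (at 0)"
    proof (rule DERIV_Re_along_curve[where g = q and \<gamma> = "\<lambda>t. exp (\<i> * of_real t) * z0"])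
      have "((\<lambda>t. exp (\<i> * t) * z0) has_field_derivative \<i> * z0) (at (of_real 0))"
        by (auto intro!: derivative_eq_intros)
      then show "((\<lambda>t. exp (\<i> * of_real t) * z0) has_vector_derivative \<i> * z0) (at 0)"
        by (rule has_vector_derivative_real_field)
    qed (use dq in simp)
    \<comment> \<open>A positive radial derivative would make \<open>Re q\<close> negative just inside the circle.\<close>
    have "Re (z0 * deriv q z0) \<le> 0"
    proof (rule ccontr)
      assume "\<not> Re (z0 * deriv q z0) \<le> 0"
      then obtain d where d: "d > 0" "\<And>h. 0 < h \<Longrightarrow> h < d \<Longrightarrow>
          Re (q (of_real (1 - h) * z0)) < Re (q (of_real 1 * z0))"
        using DERIV_pos_inc_left[OF radial] by auto
      define h where "h = min (d / 2) (1 / 2)"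
      have h: "0 < h" "h < d" "h < 1" using d(1) by (auto simp: h_def)
      have "norm (of_real (1 - h) * z0) < norm z0"
        using h z00 by (simp add: norm_mult del: of_real_diff)
      from inside[OF this] d(2)[OF h(1,2)] Re0 show False by simp
    qed
    moreover have "Re (\<i> * z0 * deriv q z0) = 0"
      by (rule DERIV_local_min[OF tangential zero_less_one])
         (use Re0 outside in \<open>simp add: norm_mult\<close>)
    moreover have "z0 * deriv q z0 = 1 - q z0 * p z0"
      using ode[OF z0D] by (simp add: algebra_simps)
    ultimately have "Im (q z0) * Re (p z0) = 0" "1 + Im (q z0) * Im (p z0) \<le> 0"
      using Re0 by (auto simp: mult.assoc)
    moreover have "Re (p z0) > 0" using pos[OF z0D] by (simp add: p_def)
    ultimately show False by simp
  qed
  have "f z / (z * deriv f z) = q z"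
    using q(2)[of z] z nz[OF z(1)] by (auto simp: F_def field_simps)
  then show ?thesis using qpos[OF z(1)] by simp
qed


text \<open>The derivative of \<open>|f|\<^sup>2\<close> along a radius has the sign of \<open>Re (cnj (f w) w f' w)\<close>, which is the sign of
\<open>Re (f w / (w f' w))\<close>.\<close>

lemma starlike_norm_increasing:
  assumes f: "f holomorphic_on unit_disc"
    and star: "\<And>z. z \<in> unit_disc \<Longrightarrow> z \<noteq> 0 \<Longrightarrow> Re (f z / (z * deriv f z)) > 0"
    and z: "z \<in> unit_disc" and t: "0 < t" "t \<le> 1"
  shows "norm (f (of_real t * z)) \<le> norm (f z)"
proof (cases "z = 0")
  case True
  then show ?thesis by simp
next
  case False
  define \<phi> where "\<phi> = (\<lambda>s::real. (norm (f (of_real s * z)))\<^sup>2)"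
  have "\<phi> t \<le> \<phi> 1"
  proof (rule DERIV_nonneg_imp_nondecreasing[OF t(2)])
    fix s :: real assume s: "t \<le> s" "s \<le> 1"
    define w where "w = of_real s * z"
    have "norm w \<le> norm z" using s t by (simp add: w_def norm_mult mult_left_le_one_le)
    then have w: "w \<in> unit_disc" "w \<noteq> 0" using z s t False by (auto simp: w_def)
    have df: "(f has_field_derivative deriv f w) (at (of_real s * z))"
      using holomorphic_derivI[OF f _ w(1)] by (simp add: w_def)
    have "((\<lambda>s. of_real s * z) has_vector_derivative z) (at s)"
      by (auto intro!: derivative_eq_intros)
    from field_vector_diff_chain_at[OF this df]
    have fv: "((\<lambda>s. f (of_real s * z)) has_vector_derivative (z * deriv f w)) (at s)"
      by (simp add: o_def)
    have "((\<lambda>s. (Re (f (of_real s * z)))\<^sup>2 + (Im (f (of_real s * z)))\<^sup>2) has_real_derivative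
        2 * Re (f w) * Re (z * deriv f w) + 2 * Im (f w) * Im (z * deriv f w)) (at s)"
      using has_field_derivative_Re[OF fv] has_field_derivative_Im[OF fv]
      by (auto intro!: derivative_eq_intros fv simp: w_def)
    moreover have "2 * Re (f w) * Re (z * deriv f w) + 2 * Im (f w) * Im (z * deriv f w) \<ge> 0"
    proof -
      have "0 < Re (f w / (w * deriv f w))" using star[OF w] .
      also have "\<dots> = (Re (f w) * Re (w * deriv f w) + Im (f w) * Im (w * deriv f w)) / (norm (w * deriv f w))\<^sup>2"
        by (simp only: Re_divide cmod_power2)
      finally have "0 < Re (f w) * Re (w * deriv f w) + Im (f w) * Im (w * deriv f w)"
        by (simp add: zero_less_divide_iff)
      also have "\<dots> = s * (Re (f w) * Re (z * deriv f w) + Im (f w) * Im (z * deriv f w))"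
        by (simp add: w_def algebra_simps)
      finally show ?thesis using s t by (simp add: zero_less_mult_iff)
    qed
    ultimately show "\<exists>y. (\<phi> has_real_derivative y) (at s) \<and> 0 \<le> y"
      unfolding \<phi>_def cmod_power2 by blast
  qed
  then show ?thesis by (simp add: \<phi>_def)
qed

section \<open>The local inverse and its logarithmic coefficients\<close>

lemma class_C_AP_D:
  assumes "f \<in> class_C_AP"
  shows "f holomorphic_on unit_disc" "f 0 = 0" "deriv f 0 = 1"
    "\<And>z. z \<in> unit_disc \<Longrightarrow> deriv f z \<noteq> 0"
    "\<exists>\<omega>. schwarz_function \<omega> \<and> (\<forall>z\<in>unit_disc. 1 + z * deriv (deriv f) z / deriv f z = psi_AP (\<omega> z))"
  using assms unfolding class_C_AP_def class_A_def subordinate_def by auto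

text \<open>By starlikeness \<open>|f|\<close> increases along radii, so its minimum on the circle of radius \<open>r\<close> will do.\<close>

lemma class_C_AP_lower_bound:
  assumes "f \<in> class_C_AP" "0 < r" "r < 1"
  obtains \<delta> where "\<delta> > 0" "\<And>z. z \<in> unit_disc \<Longrightarrow> r \<le> norm z \<Longrightarrow> \<delta> \<le> norm (f z)"
proof -
  note f = class_C_AP_D[OF assms(1)]
  obtain \<omega> where w: "schwarz_function \<omega>"
    "\<And>z. z \<in> unit_disc \<Longrightarrow> 1 + z * deriv (deriv f) z / deriv f z = psi_AP (\<omega> z)"
    using f(5) by blast
  have "Re (1 + z * deriv (deriv f) z / deriv f z) > 0" if "z \<in> unit_disc" for z
    unfolding w(2)[OF that] using w(1) that by (intro Re_psi_AP_pos) (auto simp: schwarz_function_def)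
  then have star: "Re (f z / (z * deriv f z)) > 0" if "z \<in> unit_disc" "z \<noteq> 0" for z
    using convex_imp_starlike[OF f(1,2,4) _ that] by blast
  have "continuous_on (sphere 0 r) (\<lambda>z. norm (f z))"
    using assms by (intro continuous_intros continuous_on_subset[OF holomorphic_on_imp_continuous_on[OF f(1)]]) auto
  moreover have "sphere 0 r \<noteq> ({} :: complex set)" "compact (sphere (0::complex) r)"
    using assms by auto
  ultimately obtain z1 where z1: "z1 \<in> sphere 0 r" "\<And>z. z \<in> sphere 0 r \<Longrightarrow> norm (f z1) \<le> norm (f z)"
    using continuous_attains_inf[of "sphere 0 r" "\<lambda>z. norm (f z)"] by blast
  have z1': "z1 \<in> unit_disc" "z1 \<noteq> 0" using z1(1) assms by auto
  have "f z1 \<noteq> 0" using star[OF z1'] by auto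
  moreover have "norm (f z1) \<le> norm (f z)" if z: "z \<in> unit_disc" "r \<le> norm z" for z
  proof -
    have zpos: "norm z > 0" using z assms(2) by linarith
    have "norm (f z1) \<le> norm (f (of_real (r / norm z) * z))"
      using assms zpos by (intro z1(2)) (simp add: norm_mult norm_divide)
    also have "\<dots> \<le> norm (f z)"
      by (rule starlike_norm_increasing[OF f(1) star z(1)]) (use assms z zpos in auto)
    finally show ?thesis .
  qed
  ultimately show thesis using that[of "norm (f z1)"] by auto
qed

text \<open>A preimage of \<open>w\<close> chosen anywhere in the disc has to lie in the small ball on which \<open>f\<close> is injective
as soon as \<open>|w|\<close> is below the lower bound of \<open>|f|\<close> outside that ball.\<close>

lemma inv_into_local_inverse:
  assumes "f \<in> class_C_AP"
  obtains g U where "open U" "0 \<in> U" "g holomorphic_on U" "g 0 = 0"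
    "\<And>w. w \<in> U \<Longrightarrow> g w \<in> unit_disc" "\<And>w. w \<in> U \<Longrightarrow> f (g w) = w"
    "\<And>w. w \<in> U \<Longrightarrow> inv_into unit_disc f w = g w"
    "\<forall>\<^sub>F z in nhds 0. g (f z) = z"
proof -
  note f = class_C_AP_D[OF assms]
  obtain r0 where r0: "r0 > 0" "ball 0 r0 \<subseteq> unit_disc" "inj_on f (ball 0 r0)"
    using has_complex_derivative_locally_injective[of f unit_disc 0] f by auto
  define r where "r = min r0 (1/2)"
  have r: "0 < r" "r < 1" "ball 0 r \<subseteq> unit_disc" "inj_on f (ball 0 r)"
    using r0 by (auto simp: r_def intro: inj_on_subset)
  have fr: "f holomorphic_on ball 0 r" using f(1) r(3) by (rule holomorphic_on_subset)
  obtain g where g: "g holomorphic_on f ` ball 0 r" "\<And>z. z \<in> ball 0 r \<Longrightarrow> g (f z) = z"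
    by (rule holomorphic_has_inverse[OF fr _ r(4)]) auto
  obtain \<delta> where d: "\<delta> > 0" "\<And>z. z \<in> unit_disc \<Longrightarrow> r \<le> norm z \<Longrightarrow> \<delta> \<le> norm (f z)"
    using class_C_AP_lower_bound[OF assms r(1,2)] by blast
  define U where "U = f ` ball 0 r \<inter> ball 0 \<delta>"
  have "open (f ` ball 0 r)" by (rule open_mapping_thm3[OF fr _ r(4)]) auto
  then have "open U" by (auto simp: U_def)
  moreover have "0 \<in> U" unfolding U_def using r(1) d(1) f(2) by (auto intro!: image_eqI[of _ _ 0])
  moreover have "g holomorphic_on U" using g(1) by (rule holomorphic_on_subset) (auto simp: U_def)
  moreover have "g 0 = 0" using g(2)[of 0] f(2) r(1) by simp
  moreover have "g w \<in> unit_disc" "f (g w) = w" "inv_into unit_disc f w = g w" if "w \<in> U" for w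
  proof -
    obtain z where z: "w = f z" "z \<in> ball 0 r" using \<open>w \<in> U\<close> by (auto simp: U_def)
    have gw: "g w = z" using z g(2) by simp
    show "g w \<in> unit_disc" "f (g w) = w" using z r(3) gw by auto
    define v where "v = inv_into unit_disc f w"
    have "w \<in> f ` unit_disc" using z r(3) by auto
    then have v: "v \<in> unit_disc" "f v = w"
      unfolding v_def by (rule inv_into_into, rule f_inv_into_f)
    have "norm v < r"
      using d(2)[OF v(1)] v(2) \<open>w \<in> U\<close> by (force simp: U_def)
    then show "inv_into unit_disc f w = g w"
      using g(2)[of v] v(2) by (simp add: v_def)
  qed
  moreover have "\<forall>\<^sub>F z in nhds 0. g (f z) = z"
    using eventually_nhds_in_open[of "ball 0 r" 0] r(1) g(2) by (auto elim!: eventually_mono)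
  ultimately show thesis using that by blast
qed

text \<open>Let \<open>g\<close> be the local inverse and write \<open>f z = z k z\<close>. Substituting \<open>w = f z\<close> in \<open>log (g w / w)\<close>
gives \<open>- log (k z)\<close>, and differentiation removes the logarithm. The result is an identity of power series in which the inverse of \<open>f\<close> no
longer occurs; it determines the coefficients of \<open>L\<close> recursively. The series of \<open>k\<close> is \<open>fps_shift 1 F\<close>.\<close>

lemma log_inverse_quotient_fps:
  assumes "f \<in> class_C_AP" "f has_fps_expansion F"
  obtains L where "log_inverse_quotient f has_fps_expansion L"
    "(fps_deriv L oo F) * fps_deriv F * fps_shift 1 F = - fps_deriv (fps_shift 1 F)"
proof -
  note f = class_C_AP_D[OF assms(1)]
  obtain g U where U: "open U" "0 \<in> U" and g: "g holomorphic_on U" "g 0 = 0"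
    "\<And>w. w \<in> U \<Longrightarrow> g w \<in> unit_disc" "\<And>w. w \<in> U \<Longrightarrow> f (g w) = w"
    "\<And>w. w \<in> U \<Longrightarrow> inv_into unit_disc f w = g w"
    and gf: "\<forall>\<^sub>F z in nhds 0. g (f z) = z"
    by (rule inv_into_local_inverse[OF assms(1)]) blast
  obtain k where k: "k holomorphic_on unit_disc" "\<And>z. norm z < 1 \<Longrightarrow> f z = z * k z" "deriv f 0 = k 0"
    by (rule Schwarz3[OF f(1,2)]) auto
  have k0: "k 0 = 1" using k(3) f(3) by simp
  \<comment> \<open>The principal logarithm of \<open>k\<close> is holomorphic on this neighbourhood of \<open>0\<close>.\<close>
  define H where "H = unit_disc \<inter> k -` {u. 0 < Re u}"
  have "continuous_on unit_disc k"
    using k(1) by (rule holomorphic_on_imp_continuous_on)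
  then have "open H"
    unfolding H_def by (intro continuous_open_preimage open_halfspace_Re_gt) auto
  have "0 \<in> H" using k0 by (simp add: H_def)
  have Hpos: "0 < Re (k z)" if "z \<in> H" for z using that by (simp add: H_def)
  have notneg: "k z \<notin> \<real>\<^sub>\<le>\<^sub>0" if "z \<in> H" for z
    using Hpos[OF that] by (auto simp: complex_nonpos_Reals_iff)
  define U' where "U' = U \<inter> g -` H"
  have "open U'"
    unfolding U'_def using g(1) \<open>open U\<close> \<open>open H\<close>
    by (intro continuous_open_preimage holomorphic_on_imp_continuous_on)
  have "0 \<in> U'" using U(2) g(2) \<open>0 \<in> H\<close> by (simp add: U'_def)
  have eq: "log_inverse_quotient f w = - Ln (k (g w))" if "w \<in> U'" for w
  proof (cases "w = 0")
    case True
    then show ?thesis using g(2) k0 by (simp add: log_inverse_quotient_def)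
  next
    case False
    have w: "w \<in> U" "g w \<in> H" using that by (auto simp: U'_def)
    have "w = g w * k (g w)" using k(2)[of "g w"] g(3,4)[OF w(1)] by simp
    then have "g w / w = inverse (k (g w))"
      using False by (metis inverse_eq_divide mult_eq_0_iff nonzero_divide_mult_cancel_left)
    then have "log_inverse_quotient f w = Ln (inverse (k (g w)))"
      using False g(5)[OF w(1)] by (simp add: log_inverse_quotient_def)
    also have "\<dots> = - Ln (k (g w))"
      using notneg[OF w(2)] by (intro Ln_inverse)
    finally show ?thesis .
  qed
  have "k \<circ> g holomorphic_on U'"
    by (rule holomorphic_on_compose_gen[OF holomorphic_on_subset[OF g(1)] k(1)])
       (auto simp: U'_def H_def)
  then have "(\<lambda>w. k (g w)) holomorphic_on U'"
    by (simp add: o_def)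
  then have "(\<lambda>w. - Ln (k (g w))) holomorphic_on U'"
    using notneg by (intro holomorphic_intros) (auto simp: U'_def)
  then have hol: "log_inverse_quotient f holomorphic_on U'"
    by (rule holomorphic_transform) (simp add: eq)
  define L where "L = fps_expansion (log_inverse_quotient f) 0"
  have L: "log_inverse_quotient f has_fps_expansion L"
    unfolding L_def using \<open>open U'\<close> \<open>0 \<in> U'\<close> hol by (rule has_fps_expansion_fps_expansion)
  have F0: "F $ 0 = 0"
    using has_fps_expansion_imp_0_eq_fps_nth_0[OF assms(2)] f(2) by simp
  define K where "K = fps_expansion k 0"
  have K: "k has_fps_expansion K"
    unfolding K_def using k(1) by (intro has_fps_expansion_fps_expansion[of unit_disc]) auto
  have "F = fps_X * K"
  proof (rule has_fps_expansion_unique[OF assms(2)])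
    show "(\<lambda>z. z * k z) has_fps_expansion fps_X * K"
      by (intro fps_expansion_intros K)
    show "\<forall>\<^sub>F z in nhds 0. f z = z * k z"
      by (rule eventually_unit_disc) (use k(2) in auto)
  qed
  then have KF: "K = fps_shift 1 F"
    by (metis fps_shift_times_fps_X' mult.commute)
  obtain S where S: "open S" "0 \<in> S" "\<And>z. z \<in> S \<Longrightarrow> g (f z) = z"
    using gf unfolding eventually_nhds by blast
  define W where "W = (H \<inter> S) \<inter> f -` U'"
  have WD: "W \<subseteq> unit_disc" by (auto simp: W_def H_def)
  have "open W"
    unfolding W_def using \<open>open H\<close> \<open>open S\<close> \<open>open U'\<close>
    by (intro continuous_open_preimage holomorphic_on_imp_continuous_on holomorphic_on_subset[OF f(1)])
       (auto simp: H_def)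
  have "0 \<in> W" using \<open>0 \<in> H\<close> S(2) \<open>0 \<in> U'\<close> f(2) by (simp add: W_def)
  have on_W: "log_inverse_quotient f (f z) = - Ln (k z)" if "z \<in> W" for z
    using that eq[of "f z"] S(3) by (simp add: W_def)
  define l where "l = log_inverse_quotient f \<circ> f"
  have deriv_l: "deriv l z * k z = - deriv k z" if "z \<in> W" for z
  proof -
    have z: "z \<in> unit_disc" "z \<in> H" using that WD by (auto simp: W_def)
    have "k z \<noteq> 0" using Hpos[OF z(2)] by auto
    have "((\<lambda>z. - Ln (k z)) has_field_derivative - (deriv k z / k z)) (at z)"
      using holomorphic_derivI[OF k(1) _ z(1)] notneg[OF z(2)]
      by (auto intro!: derivative_eq_intros simp: field_simps)
    then have "(l has_field_derivative - (deriv k z / k z)) (at z)"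
      by (rule has_field_derivative_transform_within_open[OF _ \<open>open W\<close> that])
         (simp add: l_def on_W)
    then show ?thesis using \<open>k z \<noteq> 0\<close> by (simp add: DERIV_imp_deriv)
  qed
  have "l has_fps_expansion (L oo F)"
    unfolding l_def by (rule has_fps_expansion_compose[OF L assms(2) F0])
  then have "(\<lambda>z. deriv l z * k z) has_fps_expansion fps_deriv (L oo F) * K"
    by (intro fps_expansion_intros K)
  moreover have "(\<lambda>z. - deriv k z) has_fps_expansion - fps_deriv K"
    by (intro fps_expansion_intros K)
  moreover have "\<forall>\<^sub>F z in nhds 0. deriv l z * k z = - deriv k z"
    using deriv_l eventually_nhds_in_open[OF \<open>open W\<close> \<open>0 \<in> W\<close>] by (auto elim!: eventually_mono)
  ultimately have "fps_deriv (L oo F) * K = - fps_deriv K"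
    by (rule has_fps_expansion_unique)
  then have "(fps_deriv L oo F) * fps_deriv F * fps_shift 1 F = - fps_deriv (fps_shift 1 F)"
    using fps_compose_deriv[OF F0, of L] KF by simp
  then show thesis using that L by blast
qed

lemma inverse_log_coeffs:
  assumes "f \<in> class_C_AP" "f has_fps_expansion F"
  shows "inverse_log_coeff f 1 = - (F $ 2) / 2"
    and "inverse_log_coeff f 2 = - (F $ 3) / 2 + 3/4 * (F $ 2)\<^sup>2"
    and "inverse_log_coeff f 3 = - (F $ 4 - 4 * F $ 2 * F $ 3 + 10/3 * (F $ 2) ^ 3) / 2"
proof -
  obtain L where L: "log_inverse_quotient f has_fps_expansion L"
    and eq: "(fps_deriv L oo F) * fps_deriv F * fps_shift 1 F = - fps_deriv (fps_shift 1 F)"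
    using log_inverse_quotient_fps[OF assms] by blast
  have coeff: "inverse_log_coeff f n = L $ n / 2" for n
    using fps_nth_fps_expansion[OF L, of n] by (simp add: inverse_log_coeff_def)
  have F0: "F $ 0 = 0"
    using has_fps_expansion_imp_0_eq_fps_nth_0[OF assms(2)] class_C_AP_D(2)[OF assms(1)] by simp
  have F1: "F $ Suc 0 = 1"
    using fps_nth_fps_expansion[OF assms(2), of 1] class_C_AP_D(3)[OF assms(1)] by simp
  have e: "((fps_deriv L oo F) * fps_deriv F * fps_shift 1 F) $ n = - of_nat (n + 1) * F $ (n + 2)" for n
    unfolding eq by (simp add: algebra_simps)
  have L1: "L $ 1 = - (F $ 2)"
    using e[of 0] F0 F1 by (simp add: numeral_2_eq_2)
  have nth: "(fps_deriv L oo F) $ 0 = L $ 1" "(fps_deriv L oo F) $ 1 = 2 * L $ 2"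
    "(fps_deriv L oo F) $ 2 = 2 * L $ 2 * F $ 2 + 3 * L $ 3"
    "fps_deriv F $ 0 = 1" "fps_deriv F $ 1 = 2 * F $ 2" "fps_deriv F $ 2 = 3 * F $ 3"
    "fps_shift 1 F $ 0 = 1" "fps_shift 1 F $ 1 = F $ 2" "fps_shift 1 F $ 2 = F $ 3"
    using fps_compose_nth_low[OF F0, of "fps_deriv L"] F1
    by (simp_all add: numeral_2_eq_2 numeral_3_eq_3)
  have "2 * L $ 2 = - 2 * F $ 3 - 3 * F $ 2 * L $ 1"
    using e[of 1] unfolding fps_mult_nth_low fps_mult_nth_0 nth
    by (simp add: algebra_simps numeral_3_eq_3[symmetric])
  then have L2: "2 * L $ 2 = - 2 * F $ 3 + 3 * (F $ 2)\<^sup>2"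
    unfolding L1 by (simp add: power2_eq_square)
  have "3 * L $ 3 = - 3 * F $ 4 - 4 * F $ 2 * (2 * L $ 2) - L $ 1 * (4 * F $ 3 + 2 * (F $ 2)\<^sup>2)"
    using e[of 2] unfolding fps_mult_nth_low fps_mult_nth_0 nth
    by (simp add: algebra_simps power2_eq_square)
  then have L3: "3 * L $ 3 = - 3 * F $ 4 + 12 * F $ 2 * F $ 3 - 10 * (F $ 2) ^ 3"
    unfolding L1 L2 by (simp add: algebra_simps power2_eq_square power3_eq_cube)
  show "inverse_log_coeff f 1 = - (F $ 2) / 2"
    using L1 by (simp add: coeff)
  show "inverse_log_coeff f 2 = - (F $ 3) / 2 + 3/4 * (F $ 2)\<^sup>2"
    using L2 by (simp add: coeff field_simps)
  have "L $ 3 = (- 3 * F $ 4 + 12 * F $ 2 * F $ 3 - 10 * (F $ 2) ^ 3) / 3"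
    using L3 by (simp add: field_simps)
  then show "inverse_log_coeff f 3 = - (F $ 4 - 4 * F $ 2 * F $ 3 + 10/3 * (F $ 2) ^ 3) / 2"
    unfolding coeff by (simp add: diff_divide_distrib add_divide_distrib)
qed

section \<open>Inverse logarithmic coefficients in terms of the Schwarz function\<close>

text \<open>The coefficients are read off from the linear differential equation
\<open>2 (1 + z) psi_AP' = (3 + 2 z) psi_AP\<close>.\<close>

lemma psi_AP_fps:
  obtains P where "psi_AP has_fps_expansion P"
    "P $ 0 = 1" "P $ 1 = 3/2" "P $ 2 = 7/8" "P $ 3 = 17/48"
proof -
  define P where "P = fps_expansion psi_AP 0"
  have P: "psi_AP has_fps_expansion P"
    unfolding P_def using psi_AP_holomorphic
    by (intro has_fps_expansion_fps_expansion[of unit_disc]) auto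
  have ode: "2 * (1 + z) * deriv psi_AP z = (3 + 2 * z) * psi_AP z" if "z \<in> unit_disc" for z
  proof -
    have nn: "1 + z \<notin> \<real>\<^sub>\<le>\<^sub>0"
      using that by (rule one_plus_notin_nonpos_Reals)
    then have nz: "csqrt (1 + z) \<noteq> 0" by auto
    have "(psi_AP has_field_derivative exp z * csqrt (1 + z) + exp z * (1 / (2 * csqrt (1 + z)))) (at z)"
      unfolding psi_AP_def[abs_def] using nn
      by (auto intro!: derivative_eq_intros simp: algebra_simps)
    then have d: "deriv psi_AP z = exp z * csqrt (1 + z) + exp z * (1 / (2 * csqrt (1 + z)))"
      by (rule DERIV_imp_deriv)
    have sq: "1 + z = csqrt (1 + z) * csqrt (1 + z)"
      by (metis power2_csqrt power2_eq_square)
    have "2 * (1 + z) * (exp z * (1 / (2 * csqrt (1 + z)))) = exp z * csqrt (1 + z)"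
      using nz by (subst sq) simp
    then show ?thesis
      unfolding d psi_AP_def by (simp add: algebra_simps)
  qed
  have "2 * (1 + fps_X) * fps_deriv P = (3 + 2 * fps_X) * P"
  proof (rule has_fps_expansion_unique)
    show "(\<lambda>z. 2 * (1 + z) * deriv psi_AP z) has_fps_expansion 2 * (1 + fps_X) * fps_deriv P"
      "(\<lambda>z. (3 + 2 * z) * psi_AP z) has_fps_expansion (3 + 2 * fps_X) * P"
      by (intro fps_expansion_intros P)+
    show "\<forall>\<^sub>F z in nhds 0. 2 * (1 + z) * deriv psi_AP z = (3 + 2 * z) * psi_AP z"
      by (rule eventually_unit_disc) (rule ode)
  qed
  then have e: "2 * fps_deriv P + fps_X * (2 * fps_deriv P) = 3 * P + fps_X * (2 * P)"
    by (simp add: algebra_simps)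
  have en: "(2 * fps_deriv P + fps_X * (2 * fps_deriv P)) $ n = (3 * P + fps_X * (2 * P)) $ n" for n
    by (simp only: e)
  note en = en[unfolded numeral_fps_const]
  have P0: "P $ 0 = 1"
    using has_fps_expansion_imp_0_eq_fps_nth_0[OF P] by (simp add: psi_AP_def)
  have P1: "P $ 1 = 3/2" using en[of 0] P0 by (simp add: field_simps)
  have "4 * P $ 2 = 7/2"
    using en[of 1] P0 P1 by (simp add: numeral_2_eq_2[symmetric])
  then have P2: "P $ 2 = 7/8" by (simp add: field_simps)
  have "6 * P $ 3 + 4 * P $ 2 = 3 * P $ 2 + 2 * P $ 1"
    using en[of 2] by (simp add: numeral_2_eq_2[symmetric] numeral_3_eq_3[symmetric])
  then have P3: "P $ 3 = 17/48" unfolding P1 P2 by (simp add: field_simps)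
  show thesis using that P P0 P1 P2 P3 by blast
qed

text \<open>Comparison of coefficients in \<open>(psi_AP \<circ> \<omega>) f' = f' + z f''\<close> expresses the coefficients of \<open>f\<close> by those
of \<open>\<omega>\<close>; these are then inserted in the formulas for the inverse logarithmic coefficients.\<close>

lemma inverse_log_coeffs_schwarz:
  assumes f: "f \<in> class_C_AP"
    and w: "schwarz_function \<omega>" "\<omega> has_fps_expansion W"
    and sub: "\<forall>z\<in>unit_disc. 1 + z * deriv (deriv f) z / deriv f z = psi_AP (\<omega> z)"
  shows "inverse_log_coeff f 1 = - 3/8 * W $ 1"
    and "inverse_log_coeff f 2 = - 1/8 * (W $ 2 - 31/24 * (W $ 1)\<^sup>2)"
    and "inverse_log_coeff f 3 = - 1/16 * (W $ 3 - 31/12 * W $ 1 * W $ 2 + 205/144 * (W $ 1) ^ 3)"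
proof -
  note fD = class_C_AP_D[OF f]
  define F where "F = fps_expansion f 0"
  have F: "f has_fps_expansion F"
    unfolding F_def using fD(1) by (intro has_fps_expansion_fps_expansion[of unit_disc]) auto
  have F1: "F $ 1 = 1"
    using fps_nth_fps_expansion[OF F, of 1] fD(3) by simp
  obtain P where P: "psi_AP has_fps_expansion P"
    "P $ 0 = 1" "P $ 1 = 3/2" "P $ 2 = 7/8" "P $ 3 = 17/48"
    by (rule psi_AP_fps)
  have W0: "W $ 0 = 0"
    using has_fps_expansion_imp_0_eq_fps_nth_0[OF w(2)] w(1) by (simp add: schwarz_function_def)
  define Q where "Q = P oo W"
  have Q: "(psi_AP \<circ> \<omega>) has_fps_expansion Q"
    unfolding Q_def by (rule has_fps_expansion_compose[OF P(1) w(2) W0])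
  have "Q * fps_deriv F = fps_deriv F + fps_X * fps_deriv (fps_deriv F)"
  proof (rule has_fps_expansion_unique)
    show "(\<lambda>z. (psi_AP \<circ> \<omega>) z * deriv f z) has_fps_expansion Q * fps_deriv F"
      "(\<lambda>z. deriv f z + z * deriv (deriv f) z) has_fps_expansion
        fps_deriv F + fps_X * fps_deriv (fps_deriv F)"
      by (intro fps_expansion_intros F Q)+
    show "\<forall>\<^sub>F z in nhds 0. (psi_AP \<circ> \<omega>) z * deriv f z = deriv f z + z * deriv (deriv f) z"
    proof (rule eventually_unit_disc)
      fix z assume "z \<in> unit_disc"
      then show "(psi_AP \<circ> \<omega>) z * deriv f z = deriv f z + z * deriv (deriv f) z"
        using bspec[OF sub, of z, symmetric] fD(4)[of z] by (simp add: field_simps)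
    qed
  qed
  then have e: "(Q * fps_deriv F) $ n = (fps_deriv F + fps_X * fps_deriv (fps_deriv F)) $ n" for n
    by simp
  have Q0: "Q $ 0 = 1" using P(2) by (simp add: Q_def)
  have Q1: "Q $ 1 = 3/2 * W $ 1"
    and Q2: "Q $ 2 = 3/2 * W $ 2 + 7/8 * (W $ 1)\<^sup>2"
    and Q3: "Q $ 3 = 3/2 * W $ 3 + 7/4 * W $ 1 * W $ 2 + 17/48 * (W $ 1) ^ 3"
    unfolding Q_def fps_compose_nth_low[OF W0] P(3-5) by simp_all
  have nth: "fps_deriv F $ 0 = 1" "fps_deriv F $ 1 = 2 * F $ 2" "fps_deriv F $ 2 = 3 * F $ 3"
    "fps_deriv F $ 3 = 4 * F $ 4"
    using F1 by (simp_all add: eval_nat_numeral)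
  have rhs: "(fps_deriv F + fps_X * fps_deriv (fps_deriv F)) $ 1 = 2 * F $ 2 + 2 * F $ 2"
    "(fps_deriv F + fps_X * fps_deriv (fps_deriv F)) $ 2 = 3 * F $ 3 + 6 * F $ 3"
    "(fps_deriv F + fps_X * fps_deriv (fps_deriv F)) $ 3 = 4 * F $ 4 + 12 * F $ 4"
    by (simp_all add: eval_nat_numeral)
  have F2: "F $ 2 = 3/4 * W $ 1"
    using e[of 1] unfolding rhs fps_mult_nth_low nth Q0 Q1 by (simp add: field_simps)
  have "6 * F $ 3 = Q $ 2 + Q $ 1 * (2 * F $ 2)"
    using e[of 2] unfolding rhs fps_mult_nth_low nth Q0 by (simp add: algebra_simps)
  then have F3: "6 * F $ 3 = 3/2 * W $ 2 + 25/8 * (W $ 1)\<^sup>2"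
    unfolding Q1 Q2 F2 by (simp add: power2_eq_square)
  have F3': "F $ 3 = (3/2 * W $ 2 + 25/8 * (W $ 1)\<^sup>2) / 6"
    unfolding F3[symmetric] by simp
  have "12 * F $ 4 = Q $ 3 + Q $ 2 * (2 * F $ 2) + Q $ 1 * (3 * F $ 3)"
    using e[of 3] unfolding rhs fps_mult_nth_low nth Q0 by (simp add: algebra_simps)
  also have "\<dots> = 3/2 * W $ 3 + 41/8 * W $ 1 * W $ 2 + 385/96 * (W $ 1) ^ 3"
    unfolding Q3 Q2 Q1 F2 F3' by (simp add: field_simps power2_eq_square power3_eq_cube)
  finally have F4: "12 * F $ 4 = 3/2 * W $ 3 + 41/8 * W $ 1 * W $ 2 + 385/96 * (W $ 1) ^ 3" .
  show "inverse_log_coeff f 1 = - 3/8 * W $ 1"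
    using inverse_log_coeffs(1)[OF f F] F2 by simp
  have F4': "F $ 4 = (3/2 * W $ 3 + 41/8 * W $ 1 * W $ 2 + 385/96 * (W $ 1) ^ 3) / 12"
    unfolding F4[symmetric] by simp
  show "inverse_log_coeff f 2 = - 1/8 * (W $ 2 - 31/24 * (W $ 1)\<^sup>2)"
    unfolding inverse_log_coeffs(2)[OF f F] F3' F2 by (simp add: field_simps power2_eq_square)
  show "inverse_log_coeff f 3 = - 1/16 * (W $ 3 - 31/12 * W $ 1 * W $ 2 + 205/144 * (W $ 1) ^ 3)"
    unfolding inverse_log_coeffs(3)[OF f F] F4' F3' F2 by (simp add: field_simps power2_eq_square power3_eq_cube)
qed

section \<open>The extremal function and the sharp bounds\<close>

text \<open>Two integrations: \<open>(log f')' = (psi_AP - 1) / z\<close>, where the right-hand side has a removable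
singularity at \<open>0\<close>, and then \<open>f\<close> from \<open>f'\<close>.\<close>

lemma extremal_function_exists:
  obtains f where "f \<in> class_C_AP"
    "\<forall>z\<in>unit_disc. 1 + z * deriv (deriv f) z / deriv f z = psi_AP z"
proof -
  obtain h where h: "h holomorphic_on unit_disc" "\<And>z. norm z < 1 \<Longrightarrow> psi_AP z - 1 = z * h z"
  proof (rule Schwarz3)
    show "(\<lambda>z. psi_AP z - 1) holomorphic_on unit_disc"
      by (intro holomorphic_intros psi_AP_holomorphic)
  qed (auto simp: psi_AP_def)
  obtain G where G: "\<And>z. z \<in> unit_disc \<Longrightarrow> (G has_field_derivative h z) (at z)"
    using holomorphic_convex_primitive'[OF _ _ h(1)] by (metis at_within_open convex_ball open_ball)
  define E where "E = (\<lambda>z. exp (G z - G 0))"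
  have E: "(E has_field_derivative h z * E z) (at z)" if "z \<in> unit_disc" for z
    unfolding E_def using G[OF that] by (auto intro!: derivative_eq_intros)
  then have "E holomorphic_on unit_disc"
    unfolding holomorphic_on_open[OF open_ball] by blast
  then obtain \<Phi> where \<Phi>: "\<And>z. z \<in> unit_disc \<Longrightarrow> (\<Phi> has_field_derivative E z) (at z)"
    using holomorphic_convex_primitive'[of unit_disc E] by (metis at_within_open convex_ball open_ball)
  define f where "f = (\<lambda>z. \<Phi> z - \<Phi> 0)"
  have f: "(f has_field_derivative E z) (at z)" if "z \<in> unit_disc" for z
    unfolding f_def using \<Phi>[OF that] by (auto intro!: derivative_eq_intros)
  have df: "deriv f z = E z" if "z \<in> unit_disc" for z
    using f[OF that] by (rule DERIV_imp_deriv)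
  have "(deriv f has_field_derivative h z * E z) (at z)" if "z \<in> unit_disc" for z
    by (rule has_field_derivative_transform_within_open[OF E[OF that] _ that]) (auto simp: df)
  then have ddf: "deriv (deriv f) z = h z * E z" if "z \<in> unit_disc" for z
    using that by (auto intro: DERIV_imp_deriv)
  have Enz: "E z \<noteq> 0" for z by (simp add: E_def)
  have eq: "1 + z * deriv (deriv f) z / deriv f z = psi_AP z" if "z \<in> unit_disc" for z
    using h(2)[of z] that Enz[of z] by (simp add: df ddf algebra_simps)
  have "f 0 = 0" "deriv f 0 = 1"
    using df[of 0] by (simp_all add: f_def E_def)
  moreover have "f holomorphic_on unit_disc"
    unfolding holomorphic_on_open[OF open_ball] using f by blast
  ultimately have "f \<in> class_A"
    by (simp add: class_A_def)
  moreover have "subordinate (\<lambda>z. 1 + z * deriv (deriv f) z / deriv f z) psi_AP"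
    unfolding subordinate_def
  proof (intro conjI exI[of _ "\<lambda>z. z"])
    show "(\<lambda>z. 1 + z * deriv (deriv f) z / deriv f z) holomorphic_on unit_disc"
      by (rule holomorphic_transform[OF psi_AP_holomorphic eq[symmetric]])
  qed (use psi_AP_holomorphic eq in \<open>auto simp: schwarz_function_def\<close>)
  ultimately have "f \<in> class_C_AP"
    unfolding class_C_AP_def using df Enz by auto
  then show thesis using that[of f] eq by blast
qed

theorem theorem3p1:
  shows "(\<forall>f\<in>class_C_AP.
            norm (inverse_log_coeff f 1) \<le> 3 / 8 \<and>
            norm (inverse_log_coeff f 2) \<le> 31 / 192 \<and>
            norm (inverse_log_coeff f 3) \<le> 205 / 2304) \<and>
         (\<exists>f\<in>class_C_AP. norm (inverse_log_coeff f 1) = 3 / 8) \<and>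
         (\<exists>f\<in>class_C_AP. norm (inverse_log_coeff f 2) = 31 / 192) \<and>
         (\<exists>f\<in>class_C_AP. norm (inverse_log_coeff f 3) = 205 / 2304)"
proof -
  have bounds: "norm (inverse_log_coeff f 1) \<le> 3 / 8 \<and>
            norm (inverse_log_coeff f 2) \<le> 31 / 192 \<and>
            norm (inverse_log_coeff f 3) \<le> 205 / 2304" if f: "f \<in> class_C_AP" for f
  proof -
    obtain \<omega> where w: "schwarz_function \<omega>"
      "\<forall>z\<in>unit_disc. 1 + z * deriv (deriv f) z / deriv f z = psi_AP (\<omega> z)"
      using class_C_AP_D(5)[OF f] by blast
    define W where "W = fps_expansion \<omega> 0"
    have W: "\<omega> has_fps_expansion W"
      unfolding W_def using w(1)
      by (intro has_fps_expansion_fps_expansion[of unit_disc]) (auto simp: schwarz_function_def)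
    obtain a x y where axy: "norm a \<le> 1" "norm x \<le> 1" "norm y \<le> 1"
      and c: "W $ 1 = a" "W $ 2 = (1 - a * cnj a) * x"
      "W $ 3 = (1 - a * cnj a) * ((1 - x * cnj x) * y - cnj a * x\<^sup>2)"
      by (rule schwarz_coeffs[OF w(1) W])
    note \<Gamma> = inverse_log_coeffs_schwarz[OF f w(1) W w(2), unfolded c]
    have "norm (inverse_log_coeff f 1) = 3/8 * norm a"
      "norm (inverse_log_coeff f 2) = 1/8 * norm ((1 - a * cnj a) * x - 31/24 * a\<^sup>2)"
      "norm (inverse_log_coeff f 3) = 1/16 * norm ((1 - a * cnj a) * ((1 - x * cnj x) * y - cnj a * x\<^sup>2)
         - 31/12 * a * ((1 - a * cnj a) * x) + 205/144 * a ^ 3)"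
      unfolding \<Gamma> norm_mult by simp_all
    then show ?thesis
      using axy(1) sharp_quadratic_bound[OF axy(1,2)] sharp_cubic_bound[OF axy] by linarith
  qed
  obtain f where f: "f \<in> class_C_AP"
    "\<forall>z\<in>unit_disc. 1 + z * deriv (deriv f) z / deriv f z = psi_AP z"
    by (rule extremal_function_exists) blast
  have id: "schwarz_function (\<lambda>z. z)" by (auto simp: schwarz_function_def)
  note \<Gamma> = inverse_log_coeffs_schwarz[OF f(1) id has_fps_expansion_fps_X f(2)]
  have "norm (inverse_log_coeff f 1) = 3 / 8" "norm (inverse_log_coeff f 2) = 31 / 192"
    "norm (inverse_log_coeff f 3) = 205 / 2304"
    unfolding \<Gamma> by (simp_all add: fps_X_def)
  with bounds f(1) show ?thesis by blast
qed

end
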